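(* Let Assumption 1 (recalled in the context) hold. Then $$J^*-\mathcal{J}^*\ \le\ \frac{1}{2N^2}\left(\max_{Q\subseteq\{1,\dots,N\},\ |Q|=q\wedge N}\ \sum_{i\in Q}\rho(\mathcal{Y}_i)^2\right)\ \le\ \frac{D[q\wedge N]}{2N^2},$$ where $q\in\mathbb{N}\cup\{+\infty\}$ is the dimension of $\mathcal{E}$ and $q\wedge N=\min(q,N)$.
   Context: Setting. $N,M\ge1$ are integers; $\mathcal{X}_1,\dots,\mathcal{X}_N$ are nonempty sets and $\mathcal{X}=\prod_{i=1}^N\mathcal{X}_i$; $\mathcal{E}_1,\dots,\mathcal{E}_M$ are separable real Hilbert spaces and $\mathcal{E}=\prod_{j=1}^M\mathcal{E}_j$ with scalar product $\langle y,y'\rangle=\sum_j\langle y_j,y_j'\rangle_{\mathcal{E}_j}$. For each $i,j$ we are given maps $g_{ij}:\mathcal{X}_i\to\mathcal{E}_j$ and $f_j:\mathcal{E}_j\to\mathbb{R}$; $g_i=(g_{ij})_{j=1,\dots,M}$, $f(y)=\sum_{j=1}^M f_j(y_j)$, $J(x)=f\big(\frac1N\sum_{i=1}^N g_i(x_i)\big)$ and $J^*=\inf_{x\in\mathcal{X}}J(x)$. Randomized problem. For a set $\Omega$, $\mathcal{P}_\delta(\Omega)$ is the set of finitely supported probability measures $\sum_{k=1}^K\lambda_k\delta_{x_k}$ on $\Omega$. For such $\mu$ and a Hilbert-space-valued $F$ on $\Omega$, $E_\mu[F]=\sum_k\lambda_kF(x_k)$ and $\sigma_\mu^2[F]=\sum_k\lambda_k\|F(x_k)-E_\mu[F]\|^2$.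 Put $\mathcal{P}_\delta=\prod_{i=1}^N\mathcal{P}_\delta(\mathcal{X}_i)$, $\mathcal{J}(\mu)=f\big(\frac1N\sum_{i=1}^NE_{\mu_i}[g_i]\big)$, $\mathcal{J}^*=\inf_{\mu\in\mathcal{P}_\delta}\mathcal{J}(\mu)$. Assumption 1. Let $S_{ij}=g_{ij}(\mathcal{X}_i)$ and $S_j=\frac1N\sum_{i=1}^NS_{ij}$ (Minkowski sum). For all $i,j$: (1) $S_{ij}$ has finite diameter $d_{ij}$; (2) $f_j$ is $L_j$-Lipschitz on $\mathrm{conv}(S_j)$; (3) $f_j$ is continuously differentiable on a neighborhood of $\mathrm{conv}(S_j)$ and $\nabla f_j$ is $\tilde L_j$-Lipschitz on $\mathrm{conv}(S_j)$, where $\tilde L_j>0$. Nonconvexity measure. For $\mathcal{K}\subseteq\mathcal{E}$, $$\rho(\mathcal{K})=\Big(\sup_{y\in\mathrm{conv}(\mathcal{K})}\ \inf_{\mu\in\mathcal{P}_\delta(\mathcal{K}),\ E_\mu[\mathrm{Id}]=y}\ \sigma^2_\mu[\mathrm{Id}]\Big)^{1/2},$$ where $\mathrm{Id}$ is the identity map. Rescaled sets and constants. $\tilde g_{ij}=\sqrt{\tilde L_j}\,g_{ij}$, $\tilde g_i=(\tilde g_{ij})_{j=1,\dots,M}$, $\mathcal{Y}_i=\tilde g_i(\mathcal{X}_i)\subseteq\mathcal{E}$. $D_i=\sum_{j=1}^M\tilde L_jd_{ij}^2$ and $D[k]=\max_{K\subseteq\{1,\dots,N\},\,|K|=k}\sum_{i\in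 K}D_i$. *)

theory Defs
  imports "HOL-Analysis.Analysis" "HOL-Probability.Probability_Mass_Function"
begin

text \<open>
  The Hilbert spaces \<open>E\<^sub>1, \<dots>, E\<^sub>M\<close> may be pairwise different. They are represented as complete
  linear subspaces \<open>E j\<close> of one ambient real inner product space \<open>'e\<close> (any such family embeds in
  its direct sum), indexed by a finite type \<open>'m\<close> with \<open>CARD('m) = M\<close>. The product space is then the
  subspace \<open>prod_space E\<close> of \<open>'e ^ 'm\<close>, whose library inner product is the sum of the
  componentwise ones. Maps defined on \<open>E j\<close> are represented by total functions
  whose values outside \<open>E j\<close> are irrelevant.
\<close>

definition separable_hilbert :: "'e::real_inner set \<Rightarrow> bool" where
  "separable_hilbert H \<longleftrightarrow> subspace H \<and> complete H \<and> separable_space (top_of_set H)"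

definition prod_space :: "('m \<Rightarrow> 'e set) \<Rightarrow> ('e ^ 'm) set" where
  "prod_space E = {y. \<forall>j. y $ j \<in> E j}"

text \<open>The library's \<open>dim\<close> is \<open>0\<close> on infinite-dimensional spaces; here they get dimension \<open>\<infinity>\<close>.\<close>

definition edim :: "'a::real_vector set \<Rightarrow> enat" where
  "edim V = (if \<exists>B. finite B \<and> V \<subseteq> span B then enat (dim V) else \<infinity>)"

text \<open>\<open>v\<close> is the gradient at \<open>y\<close> of \<open>f\<close> as a function on the Hilbert space \<open>H\<close>: the derivative is taken
  within \<open>H\<close>, which together with \<open>v \<in> H\<close> determines \<open>v\<close>.\<close>

definition has_gradient_in ::
  "'e::real_inner set \<Rightarrow> ('e \<Rightarrow> real) \<Rightarrow> 'e \<Rightarrow> 'e \<Rightarrow> bool" where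
  "has_gradient_in H f v y \<longleftrightarrow> v \<in> H \<and> (f has_derivative (\<lambda>h. v \<bullet> h)) (at y within H)"


definition finite_pmfs :: "'a set \<Rightarrow> 'a pmf set" where
  "finite_pmfs \<Omega> = {\<mu>. finite (set_pmf \<mu>) \<and> set_pmf \<mu> \<subseteq> \<Omega>}"

definition mean :: "'a pmf \<Rightarrow> ('a \<Rightarrow> 'e::real_vector) \<Rightarrow> 'e" where
  "mean \<mu> F = (\<Sum>x\<in>set_pmf \<mu>. pmf \<mu> x *\<^sub>R F x)"

definition var :: "'a pmf \<Rightarrow> ('a \<Rightarrow> 'e::real_normed_vector) \<Rightarrow> real" where
  "var \<mu> F = (\<Sum>x\<in>set_pmf \<mu>. pmf \<mu> x * (norm (F x - mean \<mu> F))\<^sup>2)"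

text \<open>The nonconvexity measure. It is real-valued, hence meaningful for nonempty bounded \<open>K\<close>, where
  the inner infimum is over a nonempty set and all variances are at most \<open>(diameter K)\<^sup>2\<close>.\<close>

definition nonconvexity :: "'e::real_normed_vector set \<Rightarrow> real" where
  "nonconvexity K =
     sqrt (SUP y\<in>convex hull K. INF \<mu>\<in>{\<mu>\<in>finite_pmfs K. mean \<mu> id = y}. var \<mu> id)"


definition vec_map :: "(nat \<Rightarrow> 'm::finite \<Rightarrow> 'x \<Rightarrow> 'e) \<Rightarrow> nat \<Rightarrow> 'x \<Rightarrow> 'e ^ 'm" where
  "vec_map g i x = (\<chi> j. g i j x)"

definition sum_fun :: "('m::finite \<Rightarrow> 'e \<Rightarrow> real) \<Rightarrow> 'e ^ 'm \<Rightarrow> real" where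
  "sum_fun f y = (\<Sum>j\<in>UNIV. f j (y $ j))"

definition J ::
  "nat \<Rightarrow> (nat \<Rightarrow> 'm::finite \<Rightarrow> 'x \<Rightarrow> 'e::real_inner) \<Rightarrow> ('m \<Rightarrow> 'e \<Rightarrow> real) \<Rightarrow> (nat \<Rightarrow> 'x) \<Rightarrow> real" where
  "J N g f x = sum_fun f ((1 / real N) *\<^sub>R (\<Sum>i=1..N. vec_map g i (x i)))"

definition J_inf ::
  "nat \<Rightarrow> (nat \<Rightarrow> 'x set) \<Rightarrow> (nat \<Rightarrow> 'm::finite \<Rightarrow> 'x \<Rightarrow> 'e::real_inner) \<Rightarrow> ('m \<Rightarrow> 'e \<Rightarrow> real) \<Rightarrow> real" where
  "J_inf N X g f = (INF x\<in>(\<Pi>\<^sub>E i\<in>{1..N}. X i). J N g f x)"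

definition J_rand ::
  "nat \<Rightarrow> (nat \<Rightarrow> 'm::finite \<Rightarrow> 'x \<Rightarrow> 'e::real_inner) \<Rightarrow> ('m \<Rightarrow> 'e \<Rightarrow> real) \<Rightarrow> (nat \<Rightarrow> 'x pmf) \<Rightarrow> real" where
  "J_rand N g f \<mu> = sum_fun f ((1 / real N) *\<^sub>R (\<Sum>i=1..N. mean (\<mu> i) (vec_map g i)))"

definition J_rand_inf ::
  "nat \<Rightarrow> (nat \<Rightarrow> 'x set) \<Rightarrow> (nat \<Rightarrow> 'm::finite \<Rightarrow> 'x \<Rightarrow> 'e::real_inner) \<Rightarrow> ('m \<Rightarrow> 'e \<Rightarrow> real) \<Rightarrow> real" where
  "J_rand_inf N X g f = (INF \<mu>\<in>(\<Pi>\<^sub>E i\<in>{1..N}. finite_pmfs (X i)). J_rand N g f \<mu>)"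


text \<open>The sum of sets is the Minkowski sum.\<close>

definition avg_set ::
  "nat \<Rightarrow> (nat \<Rightarrow> 'x set) \<Rightarrow> (nat \<Rightarrow> 'm \<Rightarrow> 'x \<Rightarrow> 'e::real_vector) \<Rightarrow> 'm \<Rightarrow> 'e set" where
  "avg_set N X g j = (\<lambda>y. (1 / real N) *\<^sub>R y) ` (\<Sum>i=1..N. g i j ` X i)"

definition assumption1 ::
  "nat \<Rightarrow> (nat \<Rightarrow> 'x set) \<Rightarrow> ('m \<Rightarrow> 'e::real_inner set) \<Rightarrow> (nat \<Rightarrow> 'm \<Rightarrow> 'x \<Rightarrow> 'e) \<Rightarrow>
     ('m \<Rightarrow> 'e \<Rightarrow> real) \<Rightarrow> ('m \<Rightarrow> real) \<Rightarrow> ('m \<Rightarrow> real) \<Rightarrow> bool" where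
  "assumption1 N X E g f L Lt \<longleftrightarrow>
     (\<forall>i\<in>{1..N}. \<forall>j. bounded (g i j ` X i)) \<and>
     (\<forall>j. (L j)-lipschitz_on (convex hull (avg_set N X g j)) (f j)) \<and>
     (\<forall>j. Lt j > 0 \<and>
        (\<exists>U G. openin (top_of_set (E j)) U \<and> convex hull (avg_set N X g j) \<subseteq> U \<and>
           (\<forall>y\<in>U. has_gradient_in (E j) (f j) (G y) y) \<and> continuous_on U G \<and>
           (Lt j)-lipschitz_on (convex hull (avg_set N X g j)) G))"


definition rescaled ::
  "('m \<Rightarrow> real) \<Rightarrow> (nat \<Rightarrow> 'm \<Rightarrow> 'x \<Rightarrow> 'e::real_vector) \<Rightarrow> nat \<Rightarrow> 'm \<Rightarrow> 'x \<Rightarrow> 'e" where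
  "rescaled Lt g i j x = sqrt (Lt j) *\<^sub>R g i j x"

definition Y ::
  "(nat \<Rightarrow> 'x set) \<Rightarrow> (nat \<Rightarrow> 'm::finite \<Rightarrow> 'x \<Rightarrow> 'e::real_vector) \<Rightarrow> ('m \<Rightarrow> real) \<Rightarrow> nat \<Rightarrow> ('e ^ 'm) set" where
  "Y X g Lt i = vec_map (rescaled Lt g) i ` X i"

definition D ::
  "(nat \<Rightarrow> 'x set) \<Rightarrow> (nat \<Rightarrow> 'm::finite \<Rightarrow> 'x \<Rightarrow> 'e::real_inner) \<Rightarrow> ('m \<Rightarrow> real) \<Rightarrow> nat \<Rightarrow> real" where
  "D X g Lt i = (\<Sum>j\<in>UNIV. Lt j * (diameter (g i j ` X i))\<^sup>2)"

definition max_sum :: "nat \<Rightarrow> nat \<Rightarrow> (nat \<Rightarrow> real) \<Rightarrow> real" where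
  "max_sum N k a = Max ((\<lambda>Q. \<Sum>i\<in>Q. a i) ` {Q. Q \<subseteq> {1..N} \<and> card Q = k})"

end

(* By the Shapley-Folkman theorem, the mean of a randomized decision can be rewritten with points
   z_i of the convex hulls of the Y_i of which all but at most min(q, N) lie in Y_i itself. Replace
   each z_i by a random point of Y_i with mean z_i and nearly minimal variance. After the rescaling
   by sqrt(Lt_j), the descent lemma bounds the increase of f by the first-order term at the mean,
   whose expectation vanishes, plus half the squared deviation, whose expectation is the sum of the
   variances divided by 2 N^2; hence some realization is at least as good. *)

theory Submission
  imports Defs
begin

text \<open>The sum of the points must be preserved exactly: gradients are taken at the mean of the
  original randomized decision, and a shift of that mean would leave a first-order error. The
  threshold is \<open>q\<close> and not \<open>q\<close> + 1 because only differences of support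
  points within a block are compared, and the mass constraint of each block is built into these
  differences. The components have different smoothness constants while \<open>nonconvexity\<close>
  uses one norm; the weights \<open>sqrt (Lt j)\<close> turn the summed quadratic remainders into a
  single squared norm. Regularity of \<open>f j\<close> is available only around the hull of
  \<open>avg_set\<close>, so both the mean and the realization have to be located there. The infimum
  inside \<open>nonconvexity\<close> need not be attained, hence the slack that is sent to 0 at the
  end.\<close>

section \<open>Finitely supported measures and convex hulls\<close>

lemma pmf_of_weights_exists:
  fixes u :: "'a \<Rightarrow> real"
  assumes "finite S" "\<And>x. x \<in> S \<Longrightarrow> 0 \<le> u x" "sum u S = 1"
  obtains \<mu> where "set_pmf \<mu> = {x\<in>S. u x \<noteq> 0}" "\<And>x. x \<in> S \<Longrightarrow> pmf \<mu> x = u x"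
proof -
  define v where "v x = (if x \<in> S then u x else 0)" for x
  have nonneg: "0 \<le> v x" for x
    using assms(2) by (simp add: v_def)
  have "(\<integral>\<^sup>+x. ennreal (v x) \<partial>count_space UNIV) = (\<Sum>x\<in>S. ennreal (v x))"
    by (rule nn_integral_count_space') (auto simp: assms(1) v_def)
  also have "\<dots> = ennreal (sum v S)"
    using nonneg by (simp add: sum_ennreal)
  also have "sum v S = 1"
    using assms(3) by (simp add: v_def)
  finally have prob: "(\<integral>\<^sup>+x. ennreal (v x) \<partial>count_space UNIV) = 1"
    by simp
  show thesis
  proof (rule that[of "embed_pmf v"])
    show "set_pmf (embed_pmf v) = {x\<in>S. u x \<noteq> 0}"
      by (subst set_embed_pmf[OF nonneg prob]) (auto simp: v_def)
    show "pmf (embed_pmf v) x = u x" if "x \<in> S" for x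
      by (subst pmf_embed_pmf[OF nonneg prob]) (simp add: v_def that)
  qed
qed

text \<open>Lets a mean be computed over a fixed finite set even after some of its weights have
  become zero and left the support.\<close>

lemma mean_superset:
  assumes "finite A" "set_pmf \<mu> \<subseteq> A"
  shows "mean \<mu> F = (\<Sum>x\<in>A. pmf \<mu> x *\<^sub>R F x)"
  unfolding mean_def
  by (rule sum.mono_neutral_left) (use assms in \<open>auto simp: set_pmf_iff\<close>)

lemma mean_return_pmf [simp]: "mean (return_pmf x) F = F x"
  by (simp add: mean_def)

lemma var_return_pmf [simp]: "var (return_pmf x) F = 0"
  by (simp add: var_def)

lemma return_pmf_in_finite_pmfs [simp]: "return_pmf x \<in> finite_pmfs K \<longleftrightarrow> x \<in> K"
  by (simp add: finite_pmfs_def)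

lemma mean_in_convex_hull:
  assumes "\<mu> \<in> finite_pmfs K"
  shows "mean \<mu> F \<in> convex hull (F ` K)"
  unfolding mean_def
  by (rule convex_sum)
     (use assms in \<open>auto simp: finite_pmfs_def sum_pmf_eq_1 intro!: hull_inc\<close>)

lemma convex_hull_eq_means: "convex hull K = (\<lambda>\<mu>. mean \<mu> id) ` finite_pmfs K"
proof
  show "convex hull K \<subseteq> (\<lambda>\<mu>. mean \<mu> id) ` finite_pmfs K"
  proof
    fix y assume "y \<in> convex hull K"
    then obtain S u where S: "finite S" "S \<subseteq> K" "\<And>x. x \<in> S \<Longrightarrow> 0 \<le> u x" "sum u S = 1"
      and y: "(\<Sum>x\<in>S. u x *\<^sub>R x) = y"
      unfolding convex_hull_explicit by blast
    obtain \<mu> where \<mu>: "set_pmf \<mu> = {x\<in>S. u x \<noteq> 0}" "\<And>x. x \<in> S \<Longrightarrow> pmf \<mu> x = u x"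
      using pmf_of_weights_exists[OF S(1,3,4)] by blast
    have "mean \<mu> id = y"
      using mean_superset[of S \<mu> id] S(1) \<mu> y by auto
    moreover have "\<mu> \<in> finite_pmfs K"
      using S \<mu>(1) by (auto simp: finite_pmfs_def)
    ultimately show "y \<in> (\<lambda>\<mu>. mean \<mu> id) ` finite_pmfs K"
      by blast
  qed
  show "(\<lambda>\<mu>. mean \<mu> id) ` finite_pmfs K \<subseteq> convex hull K"
    using mean_in_convex_hull[of _ K id] by auto
qed

lemma mean_le:
  fixes F :: "'a \<Rightarrow> real"
  assumes "finite (set_pmf \<mu>)" "\<And>x. x \<in> set_pmf \<mu> \<Longrightarrow> F x \<le> b"
  shows "mean \<mu> F \<le> b"
proof -
  have "mean \<mu> F \<le> (\<Sum>x\<in>set_pmf \<mu>. pmf \<mu> x * b)"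
    unfolding mean_def by (intro sum_mono) (simp add: assms(2) mult_left_mono)
  then show ?thesis
    by (simp add: sum_distrib_right[symmetric] sum_pmf_eq_1 assms(1))
qed

lemma exists_le_mean:
  fixes F :: "'a \<Rightarrow> real"
  assumes "finite (set_pmf \<mu>)"
  obtains x where "x \<in> set_pmf \<mu>" "F x \<le> mean \<mu> F"
proof -
  define b where "b = Min (F ` set_pmf \<mu>)"
  have "b \<in> F ` set_pmf \<mu>"
    unfolding b_def using assms set_pmf_not_empty by (intro Min_in) auto
  then obtain x where x: "x \<in> set_pmf \<mu>" "F x = b"
    by blast
  have "b = (\<Sum>y\<in>set_pmf \<mu>. pmf \<mu> y * b)"
    by (simp add: sum_distrib_right[symmetric] sum_pmf_eq_1 assms)
  also have "\<dots> \<le> mean \<mu> F"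
    unfolding mean_def b_def by (intro sum_mono) (simp add: assms mult_left_mono)
  finally show thesis
    using that x by simp
qed

section \<open>The Shapley-Folkman theorem\<close>

text \<open>Vectors are counted with their indices, since differences coming from distinct blocks
  may coincide. If two indices carry the same vector, the coefficients 1 and -1 already give a
  dependency; otherwise the image has as many elements as \<open>A\<close>.\<close>

lemma linear_dependence_family:
  fixes v :: "'i \<Rightarrow> 'a::real_vector"
  assumes "finite A" "v ` A \<subseteq> span B" "finite B" "card B < card A"
  obtains c a where "a \<in> A" "c a \<noteq> 0" "(\<Sum>a\<in>A. c a *\<^sub>R v a) = 0"
proof (cases "inj_on v A")
  case True
  have "dependent (v ` A)"
    using independent_span_bound[OF assms(3) _ assms(2)] assms(4) card_image[OF True]
    by (metis leD)
  then obtain u w where u: "w \<in> v ` A" "u w \<noteq> 0" "(\<Sum>w\<in>v ` A. u w *\<^sub>R w) = 0"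
    using dependent_finite[of "v ` A"] assms(1) by auto
  then show thesis
    using that[of _ "u \<circ> v"] True by (auto simp: sum.reindex)
next
  case False
  then obtain a b where ab: "a \<in> A" "b \<in> A" "a \<noteq> b" "v a = v b"
    by (auto simp: inj_on_def)
  define c where "c x = (if x = a then 1 else if x = b then -1 else 0 :: real)" for x
  have "(\<Sum>x\<in>A. c x *\<^sub>R v x) = (\<Sum>x\<in>{a,b}. c x *\<^sub>R v x)"
    by (rule sum.mono_neutral_right) (use ab assms(1) in \<open>auto simp: c_def\<close>)
  also have "\<dots> = 0"
    using ab by (simp add: c_def)
  finally show thesis
    using that[of a c] ab by (simp add: c_def)
qed

text \<open>A representation with the fewest support points has \<open>\<Sum>i\<in>I. card (set_pmf (\<mu> i)) - 1\<close> at
  most \<open>card B\<close>: otherwise the differences of support points within the blocks are linearly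
  dependent, and moving along a dependency until a weight vanishes removes a support point.\<close>

lemma Shapley_Folkman:
  fixes S :: "'i \<Rightarrow> 'a::real_vector set"
  assumes I: "finite I" and V: "subspace V" "\<And>i. i \<in> I \<Longrightarrow> S i \<subseteq> V"
    and B: "V \<subseteq> span B" "finite B"
    and y: "\<And>i. i \<in> I \<Longrightarrow> y i \<in> convex hull S i"
  obtains z where "\<And>i. i \<in> I \<Longrightarrow> z i \<in> convex hull S i" "sum z I = sum y I"
    "card {i\<in>I. z i \<notin> S i} \<le> card B"
proof -
  define rep where "rep \<mu> \<longleftrightarrow> (\<forall>i\<in>I. \<mu> i \<in> finite_pmfs (S i)) \<and> (\<Sum>i\<in>I. mean (\<mu> i) id) = sum y I"
    for \<mu> :: "'i \<Rightarrow> 'a pmf"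
  define m where "m \<mu> = (\<Sum>i\<in>I. card (set_pmf (\<mu> i)))" for \<mu> :: "'i \<Rightarrow> 'a pmf"
  have "\<forall>i\<in>I. \<exists>\<mu>. \<mu> \<in> finite_pmfs (S i) \<and> mean \<mu> id = y i"
    using y unfolding convex_hull_eq_means by (metis imageE)
  then obtain \<mu>0 where "\<forall>i\<in>I. \<mu>0 i \<in> finite_pmfs (S i) \<and> mean (\<mu>0 i) id = y i"
    by metis
  then have "rep \<mu>0"
    by (simp add: rep_def)
  from ex_has_least_nat[of rep, OF this, of m]
  obtain \<mu> where \<mu>: "rep \<mu>" and least: "\<And>\<nu>. rep \<nu> \<Longrightarrow> m \<mu> \<le> m \<nu>"
    by blast
  define P where "P i = set_pmf (\<mu> i)" for i
  have P: "finite (P i)" "P i \<subseteq> S i" if "i \<in> I" for i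
    using \<mu> that by (auto simp: rep_def P_def finite_pmfs_def)
  have P_ne: "P i \<noteq> {}" for i
    by (simp add: P_def set_pmf_not_empty)
  have sumP: "(\<Sum>p\<in>P i. pmf (\<mu> i) p) = 1" if "i \<in> I" for i
    using P[OF that] by (simp add: P_def sum_pmf_eq_1)
  have bound: "(\<Sum>i\<in>I. card (P i) - 1) \<le> card B"
  proof (rule ccontr)
    assume "\<not> ?thesis"
    then have big: "card B < (\<Sum>i\<in>I. card (P i) - 1)"
      by simp
    define b where "b i = (SOME p. p \<in> P i)" for i
    have b: "b i \<in> P i" for i
      unfolding b_def using P_ne by (simp add: some_in_eq)
    define A where "A = Sigma I (\<lambda>i. P i - {b i})"
    define v where "v = (\<lambda>(i, p). p - b i)"
    have A: "finite A"
      unfolding A_def using I P by auto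
    have "card A = (\<Sum>i\<in>I. card (P i) - 1)"
      unfolding A_def using I P b by (simp add: card_SigmaI)
    moreover have "v ` A \<subseteq> span B"
    proof
      fix w assume "w \<in> v ` A"
      then obtain i p where "i \<in> I" "p \<in> P i" "w = p - b i"
        by (auto simp: A_def v_def)
      then have "w \<in> V"
        using P(2)[of i] V b[of i] by (auto intro!: subspace_diff)
      then show "w \<in> span B"
        using B by blast
    qed
    ultimately obtain c a where c: "a \<in> A" "c a \<noteq> 0" "(\<Sum>a\<in>A. c a *\<^sub>R v a) = 0"
      using linear_dependence_family[of A v B] A B big by metis
    \<comment> \<open>The base point absorbs the opposite weight, so \<open>d\<close> sums to zero
      on each block and moving along it keeps every total mass equal to 1.\<close>
    define d where "d i p = (if p = b i then - (\<Sum>p\<in>P i - {b i}. c (i, p)) else c (i, p))" for i p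
    have d_sum: "(\<Sum>p\<in>P i. d i p) = 0" if "i \<in> I" for i
      using P(1)[OF that] b[of i] by (simp add: sum.remove[of "P i" "b i"] d_def)
    have d_vec: "(\<Sum>p\<in>P i. d i p *\<^sub>R p) = (\<Sum>p\<in>P i - {b i}. c (i, p) *\<^sub>R v (i, p))" if "i \<in> I" for i
      using P(1)[OF that] b[of i]
      by (simp add: sum.remove[of "P i" "b i"] d_def v_def scaleR_sum_left sum_subtractf algebra_simps)
    have d_total: "(\<Sum>i\<in>I. \<Sum>p\<in>P i. d i p *\<^sub>R p) = 0"
    proof -
      have "(\<Sum>i\<in>I. \<Sum>p\<in>P i. d i p *\<^sub>R p) = (\<Sum>i\<in>I. \<Sum>p\<in>P i - {b i}. c (i, p) *\<^sub>R v (i, p))"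
        by (simp add: d_vec)
      also have "\<dots> = (\<Sum>a\<in>A. c a *\<^sub>R v a)"
        unfolding A_def using I P by (subst sum.Sigma) (auto intro!: sum.cong)
      finally show ?thesis
        using c(3) by simp
    qed
    obtain i0 p0 where ip0: "i0 \<in> I" "p0 \<in> P i0" "p0 \<noteq> b i0" "c (i0, p0) \<noteq> 0"
      using c(1,2) by (cases a) (auto simp: A_def)
    then have i0: "i0 \<in> I" "p0 \<in> P i0" "d i0 p0 \<noteq> 0"
      by (simp_all add: d_def)
    \<comment> \<open>A zero sum with a nonzero entry forces a negative entry, so some weight does
      decrease along \<open>d\<close>.\<close>
    have "\<exists>p\<in>P i0. d i0 p < 0"
    proof (rule ccontr)
      assume "\<not> ?thesis"
      then have "\<forall>p\<in>P i0. d i0 p = 0"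
        using d_sum[OF i0(1)] P(1)[OF i0(1)] by (subst (asm) sum_nonneg_eq_0_iff) force+
      with i0 show False
        by blast
    qed
    then obtain p1 where p1: "p1 \<in> P i0" "d i0 p1 < 0"
      by blast
    define Neg where "Neg = {(i, p). i \<in> I \<and> p \<in> P i \<and> d i p < 0}"
    have "Neg \<subseteq> Sigma I P"
      by (auto simp: Neg_def)
    then have Neg: "finite Neg" "Neg \<noteq> {}"
      using I P p1 i0(1) by (auto intro: finite_subset simp: Neg_def)
    \<comment> \<open>\<open>r\<close> is the step length at which a decreasing weight reaches 0.
      Its minimum \<open>t\<close> over all blocks keeps every weight nonnegative and makes at least
      one vanish.\<close>
    define r where "r = (\<lambda>(i, p). pmf (\<mu> i) p / - d i p)"
    define t where "t = Min (r ` Neg)"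
    have t_nonneg: "t \<ge> 0"
      unfolding t_def using Neg by (subst Min_ge_iff) (auto simp: Neg_def r_def divide_nonneg_neg)
    define w where "w i p = pmf (\<mu> i) p + t * d i p" for i p
    have w_nonneg: "0 \<le> w i p" if "i \<in> I" "p \<in> P i" for i p
    proof (cases "d i p < 0")
      case True
      then have "t \<le> r (i, p)"
        unfolding t_def using Neg that by (intro Min_le) (auto simp: Neg_def)
      then have "t * - d i p \<le> r (i, p) * - d i p"
        using True by (intro mult_right_mono) auto
      also have "\<dots> = pmf (\<mu> i) p"
        using True by (simp add: r_def)
      finally show ?thesis
        by (simp add: w_def)
    qed (use t_nonneg in \<open>simp add: w_def\<close>)
    have w_sum: "(\<Sum>p\<in>P i. w i p) = 1" if "i \<in> I" for i
      using sumP[OF that] d_sum[OF that] by (simp add: w_def sum.distrib sum_distrib_left[symmetric])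
    have "\<forall>i\<in>I. \<exists>\<nu>. set_pmf \<nu> = {p\<in>P i. w i p \<noteq> 0} \<and> (\<forall>p\<in>P i. pmf \<nu> p = w i p)"
    proof
      fix i assume i: "i \<in> I"
      show "\<exists>\<nu>. set_pmf \<nu> = {p\<in>P i. w i p \<noteq> 0} \<and> (\<forall>p\<in>P i. pmf \<nu> p = w i p)"
        by (rule pmf_of_weights_exists[of "P i" "w i"]) (use P(1) w_nonneg w_sum i in auto)
    qed
    then obtain \<nu> where \<nu>: "\<And>i. i \<in> I \<Longrightarrow> set_pmf (\<nu> i) = {p\<in>P i. w i p \<noteq> 0}"
      "\<And>i p. i \<in> I \<Longrightarrow> p \<in> P i \<Longrightarrow> pmf (\<nu> i) p = w i p"
      by metis
    have mean_\<nu>: "mean (\<nu> i) id = mean (\<mu> i) id + t *\<^sub>R (\<Sum>p\<in>P i. d i p *\<^sub>R p)" if "i \<in> I" for i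
    proof -
      have "mean (\<nu> i) id = (\<Sum>p\<in>P i. w i p *\<^sub>R p)"
        using mean_superset[of "P i" "\<nu> i" id] P that \<nu> by auto
      then show ?thesis
        by (simp add: w_def mean_def P_def scaleR_add_left sum.distrib scaleR_sum_right)
    qed
    have "(\<Sum>i\<in>I. mean (\<nu> i) id) = (\<Sum>i\<in>I. mean (\<mu> i) id) + t *\<^sub>R (\<Sum>i\<in>I. \<Sum>p\<in>P i. d i p *\<^sub>R p)"
      by (simp add: mean_\<nu> sum.distrib scaleR_sum_right)
    moreover have "\<nu> i \<in> finite_pmfs (S i)" if "i \<in> I" for i
      using P that \<nu> by (auto simp: finite_pmfs_def)
    ultimately have "rep \<nu>"
      using \<mu> by (simp add: rep_def d_total)
    moreover have "m \<nu> < m \<mu>"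
      unfolding m_def
    proof (rule sum_strict_mono_ex1[OF I])
      show "\<forall>i\<in>I. card (set_pmf (\<nu> i)) \<le> card (set_pmf (\<mu> i))"
        using P(1) by (auto simp: \<nu> P_def intro!: card_mono)
      have "t \<in> r ` Neg"
        unfolding t_def using Neg by (intro Min_in) auto
      then obtain i p where ip: "i \<in> I" "p \<in> P i" "d i p < 0" "t = pmf (\<mu> i) p / - d i p"
        by (auto simp: Neg_def r_def)
      then have "w i p = 0"
        by (simp add: w_def)
      then have "set_pmf (\<nu> i) \<subset> P i"
        using ip by (auto simp: \<nu>)
      then have "card (set_pmf (\<nu> i)) < card (set_pmf (\<mu> i))"
        using P(1)[OF ip(1)] by (simp add: P_def psubset_card_mono)
      then show "\<exists>i\<in>I. card (set_pmf (\<nu> i)) < card (set_pmf (\<mu> i))"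
        using ip(1) by blast
    qed
    ultimately show False
      using least by fastforce
  qed
  define z where "z i = mean (\<mu> i) id" for i
  define Q where "Q = {i\<in>I. z i \<notin> S i}"
  \<comment> \<open>A point mass on \<open>S i\<close> has its mean in \<open>S i\<close>, so each
    index of \<open>Q\<close> has at least two support points and uses up one unit of the excess
    bounded above.\<close>
  have "1 \<le> card (P i) - 1" if "i \<in> Q" for i
  proof (rule ccontr)
    have i: "i \<in> I" "z i \<notin> S i"
      using that by (auto simp: Q_def)
    assume "\<not> ?thesis"
    moreover have "card (P i) \<noteq> 0"
      using P(1)[OF i(1)] P_ne[of i] by simp
    ultimately have "card (P i) = 1"
      by simp
    then obtain p where p: "P i = {p}"
      using card_1_singletonE by blast
    then have "\<mu> i = return_pmf p"
      using set_pmf_subset_singleton[of "\<mu> i" p] by (simp add: P_def)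
    then have "z i = p"
      by (simp add: z_def)
    then show False
      using p P(2)[OF i(1)] i(2) by simp
  qed
  then have "card Q \<le> (\<Sum>i\<in>Q. card (P i) - 1)"
    using sum_mono[of Q "\<lambda>_. 1" "\<lambda>i. card (P i) - 1"] by simp
  also have "\<dots> \<le> (\<Sum>i\<in>I. card (P i) - 1)"
    using I by (intro sum_mono2) (auto simp: Q_def)
  finally have "card Q \<le> card B"
    using bound by simp
  moreover have "z i \<in> convex hull S i" if "i \<in> I" for i
    using \<mu> that by (auto simp: rep_def z_def convex_hull_eq_means)
  moreover have "sum z I = sum y I"
    using \<mu> by (simp add: rep_def z_def)
  ultimately show thesis
    using that unfolding Q_def by blast
qed

section \<open>Selection of a realization and the descent inequality\<close>

text \<open>Choosing the points one after the other, each below its conditional expectation, replaces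
  the expectation over independent draws.\<close>

lemma exists_selection_le_variance:
  fixes F :: "'i \<Rightarrow> 'a \<Rightarrow> 'v::real_inner"
  assumes "finite I" "\<And>i. i \<in> I \<Longrightarrow> finite (set_pmf (\<mu> i))"
  obtains x where "\<And>i. i \<in> I \<Longrightarrow> x i \<in> set_pmf (\<mu> i)"
    "2 * (w \<bullet> (\<Sum>i\<in>I. F i (x i) - mean (\<mu> i) (F i))) + (norm (\<Sum>i\<in>I. F i (x i) - mean (\<mu> i) (F i)))\<^sup>2
       \<le> (\<Sum>i\<in>I. var (\<mu> i) (F i))"
  using assms
proof (induction I arbitrary: thesis rule: finite_induct)
  case empty
  then show ?case
    by simp
next
  case (insert k I)
  define c where "c i y = F i y - mean (\<mu> i) (F i)" for i y
  obtain x where x: "\<And>i. i \<in> I \<Longrightarrow> x i \<in> set_pmf (\<mu> i)"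
    "2 * (w \<bullet> (\<Sum>i\<in>I. c i (x i))) + (norm (\<Sum>i\<in>I. c i (x i)))\<^sup>2 \<le> (\<Sum>i\<in>I. var (\<mu> i) (F i))"
    using insert.IH insert.prems(2) unfolding c_def by blast
  define z where "z = (\<Sum>i\<in>I. c i (x i))"
  have fin: "finite (set_pmf (\<mu> k))"
    using insert.prems by simp
  \<comment> \<open>\<open>h y\<close> is the change of the left-hand side when \<open>c k y\<close>
    is added: the cross term with the deviations \<open>z\<close> already chosen merges with
    \<open>w\<close>. Since \<open>c k\<close> has mean zero, only the variance survives in the mean
    of \<open>h\<close>.\<close>
  define h where "h y = 2 * ((w + z) \<bullet> c k y) + (norm (c k y))\<^sup>2" for y
  have "(\<Sum>y\<in>set_pmf (\<mu> k). pmf (\<mu> k) y *\<^sub>R c k y) = 0"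
    using fin by (simp add: c_def scaleR_diff_right sum_subtractf mean_def
        scaleR_sum_left[symmetric] sum_pmf_eq_1)
  then have "(w + z) \<bullet> (\<Sum>y\<in>set_pmf (\<mu> k). pmf (\<mu> k) y *\<^sub>R c k y) = 0"
    by simp
  then have "(\<Sum>y\<in>set_pmf (\<mu> k). pmf (\<mu> k) y * ((w + z) \<bullet> c k y)) = 0"
    by (simp add: inner_sum_right)
  moreover have "mean (\<mu> k) h = 2 * (\<Sum>y\<in>set_pmf (\<mu> k). pmf (\<mu> k) y * ((w + z) \<bullet> c k y)) + var (\<mu> k) (F k)"
    by (simp add: mean_def[of _ h] h_def var_def c_def[symmetric] distrib_left sum.distrib
        sum_distrib_left mult.left_commute)
  ultimately have "mean (\<mu> k) h = var (\<mu> k) (F k)"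
    by simp
  then obtain y where y: "y \<in> set_pmf (\<mu> k)" "h y \<le> var (\<mu> k) (F k)"
    using exists_le_mean[OF fin] by metis
  have upd: "(\<Sum>i\<in>insert k I. c i ((x(k := y)) i)) = c k y + z"
    using insert.hyps by (auto simp: z_def intro!: sum.cong)
  have "2 * (w \<bullet> (c k y + z)) + (norm (c k y + z))\<^sup>2 = (2 * (w \<bullet> z) + (norm z)\<^sup>2) + h y"
    by (simp add: h_def power2_norm_eq_inner inner_add_left inner_add_right inner_commute)
  also have "\<dots> \<le> (\<Sum>i\<in>insert k I. var (\<mu> i) (F i))"
    using x(2) y(2) insert.hyps by (simp add: z_def)
  finally have "2 * (w \<bullet> (c k y + z)) + (norm (c k y + z))\<^sup>2 \<le> (\<Sum>i\<in>insert k I. var (\<mu> i) (F i))" .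
  moreover have "(x(k := y)) i \<in> set_pmf (\<mu> i)" if "i \<in> insert k I" for i
    using x(1) y(1) that by auto
  ultimately show ?case
    by (intro insert.prems(1)[of "x(k := y)"]) (simp_all only: c_def[symmetric] upd)
qed

text \<open>The mean value theorem on the segment from \<open>x\<close> to \<open>y\<close>, applied
  to \<open>f\<close> minus its linear and quadratic terms: by Cauchy-Schwarz and the Lipschitz
  gradient the slope of this difference is nonpositive. Derivatives are taken within
  \<open>C\<close>, because the hulls in question may have empty interior.\<close>

lemma descent_lemma:
  fixes f :: "'e::real_inner \<Rightarrow> real"
  assumes C: "convex C" "x \<in> C" "y \<in> C"
    and grad: "\<And>z. z \<in> C \<Longrightarrow> (f has_derivative (\<lambda>h. G z \<bullet> h)) (at z within C)"
    and lip: "L-lipschitz_on C G"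
  shows "f y \<le> f x + G x \<bullet> (y - x) + L / 2 * (norm (y - x))\<^sup>2"
proof -
  define p where "p t = x + t *\<^sub>R (y - x)" for t :: real
  have p_C: "p t \<in> C" if "0 \<le> t" "t \<le> 1" for t
    using convexD_alt[OF C(1,2,3) that] by (simp add: p_def algebra_simps)
  define \<psi> where "\<psi> t = f (p t) - t * (G x \<bullet> (y - x)) - L / 2 * t\<^sup>2 * (norm (y - x))\<^sup>2" for t
  have "\<exists>t\<in>{0..1}. \<psi> 1 - \<psi> 0 =
      (\<lambda>h. h * (G (p t) \<bullet> (y - x)) - h * (G x \<bullet> (y - x)) - h * (L * t * (norm (y - x))\<^sup>2)) (1 - 0)"
  proof (rule mvt_very_simple)
    fix t :: real assume t: "0 \<le> t" "t \<le> 1"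
    have dp: "(p has_derivative (\<lambda>h. h *\<^sub>R (y - x))) (at t within {0..1})"
      unfolding p_def by (auto intro!: derivative_eq_intros)
    have "(f has_derivative (\<lambda>h. G (p t) \<bullet> h)) (at (p t) within p ` {0..1})"
      by (rule has_derivative_subset[OF grad]) (use t p_C in auto)
    from has_derivative_in_compose[OF dp this]
    have "((\<lambda>t. f (p t)) has_derivative (\<lambda>h. h * (G (p t) \<bullet> (y - x)))) (at t within {0..1})"
      by simp
    then show "(\<psi> has_derivative (\<lambda>h. h * (G (p t) \<bullet> (y - x)) - h * (G x \<bullet> (y - x))
        - h * (L * t * (norm (y - x))\<^sup>2))) (at t within {0..1})"
      unfolding \<psi>_def by (auto intro!: derivative_eq_intros simp: algebra_simps)
  qed simp
  then obtain t where t: "t \<in> {0..1}"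
    "\<psi> 1 - \<psi> 0 = (G (p t) - G x) \<bullet> (y - x) - L * t * (norm (y - x))\<^sup>2"
    by (auto simp: inner_diff_left)
  have "(G (p t) - G x) \<bullet> (y - x) \<le> norm (G (p t) - G x) * norm (y - x)"
    by (rule norm_cauchy_schwarz)
  also have "\<dots> \<le> (L * norm (p t - x)) * norm (y - x)"
    using lipschitz_onD[OF lip, of "p t" x] p_C t(1) C(2)
    by (intro mult_right_mono) (auto simp: dist_norm)
  also have "\<dots> = L * t * (norm (y - x))\<^sup>2"
    using t(1) by (simp add: p_def power2_eq_square)
  finally have "\<psi> 1 \<le> \<psi> 0"
    using t(2) by simp
  then show ?thesis
    by (simp add: \<psi>_def p_def)
qed

section \<open>The nonconvexity measure\<close>

lemma var_nonneg: "0 \<le> var \<mu> F"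
  by (simp add: var_def sum_nonneg)

text \<open>Real-valued infima and suprema are informative only over nonempty sets bounded on the
  relevant side. Variances are bounded below by 0, and the uniform bound \<open>b\<close> makes the
  outer supremum finite.\<close>

lemma
  fixes K :: "'e::real_normed_vector set"
  assumes "K \<noteq> {}" and bound: "\<And>\<mu>. \<mu> \<in> finite_pmfs K \<Longrightarrow> var \<mu> id \<le> b"
  shows nonconvexity_sq_le: "(nonconvexity K)\<^sup>2 \<le> b"
    and ex_var_less_nonconvexity_sq: "y \<in> convex hull K \<Longrightarrow> 0 < \<epsilon> \<Longrightarrow>
      \<exists>\<mu>\<in>finite_pmfs K. mean \<mu> id = y \<and> var \<mu> id < (nonconvexity K)\<^sup>2 + \<epsilon>"
proof -
  define R where "R y = {\<mu>\<in>finite_pmfs K. mean \<mu> id = y}" for y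
  define v where "v y = (INF \<mu>\<in>R y. var \<mu> id)" for y
  have R_ne: "R y \<noteq> {}" if "y \<in> convex hull K" for y
    using that by (auto simp: R_def convex_hull_eq_means)
  have bdd: "bdd_below ((\<lambda>\<mu>. var \<mu> id) ` R y)" for y
    by (rule bdd_belowI[of _ 0]) (auto simp: var_nonneg)
  have v_bounds: "0 \<le> v y" "v y \<le> b" if "y \<in> convex hull K" for y
  proof -
    show "0 \<le> v y"
      unfolding v_def using R_ne[OF that] by (intro cINF_greatest) (auto simp: var_nonneg)
    have "\<exists>\<mu>. \<mu> \<in> R y"
      using R_ne[OF that] by blast
    then obtain \<mu> where "\<mu> \<in> R y" ..
    then show "v y \<le> b"
      unfolding v_def using bdd bound by (intro cINF_lower2[of _ _ \<mu>]) (auto simp: R_def)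
  qed
  have bdd_v: "bdd_above (v ` (convex hull K))"
    using v_bounds by (intro bdd_aboveI[of _ b]) auto
  obtain y0 where y0: "y0 \<in> convex hull K"
    using assms(1) by (auto intro: hull_inc)
  \<comment> \<open>For a negative supremum, squaring would not undo \<open>sqrt\<close>.\<close>
  have "0 \<le> (SUP y\<in>convex hull K. v y)"
    using v_bounds(1)[OF y0] by (intro cSUP_upper2[OF bdd_v y0])
  then have sq: "(nonconvexity K)\<^sup>2 = (SUP y\<in>convex hull K. v y)"
    by (simp add: nonconvexity_def v_def R_def)
  show "(nonconvexity K)\<^sup>2 \<le> b"
    unfolding sq using y0 v_bounds by (intro cSUP_least) auto
  show "\<exists>\<mu>\<in>finite_pmfs K. mean \<mu> id = y \<and> var \<mu> id < (nonconvexity K)\<^sup>2 + \<epsilon>"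
    if "y \<in> convex hull K" "0 < \<epsilon>"
  proof -
    have "v y \<le> (nonconvexity K)\<^sup>2"
      unfolding sq by (rule cSUP_upper[OF that(1) bdd_v])
    then have "v y < (nonconvexity K)\<^sup>2 + \<epsilon>"
      using that(2) by simp
    then have "\<exists>\<mu>\<in>R y. var \<mu> id < (nonconvexity K)\<^sup>2 + \<epsilon>"
      unfolding v_def using R_ne[OF that(1)] bdd by (subst (asm) cINF_less_iff) auto
    then show ?thesis
      by (auto simp: R_def)
  qed
qed

section \<open>Maximal sums over index sets of given size\<close>

lemma finite_subsets_card: "finite {Q. Q \<subseteq> {1..N::nat} \<and> card Q = k}"
  by (rule finite_subset[of _ "Pow {1..N}"]) auto

text \<open>\<open>max_sum\<close> looks only at sets of exactly \<open>k\<close> indices, while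
  fewer blocks may have left their sets; nonnegative terms allow \<open>Q\<close> to be
  enlarged.\<close>

lemma sum_le_max_sum:
  assumes "Q \<subseteq> {1..N}" "card Q \<le> k" "k \<le> N" "\<And>i. i \<in> {1..N} \<Longrightarrow> 0 \<le> a i"
  shows "sum a Q \<le> max_sum N k a"
proof -
  obtain R where R: "Q \<subseteq> R" "R \<subseteq> {1..N}" "card R = k"
    using exists_subset_between[of Q k "{1..N}"] assms by auto
  have "sum a Q \<le> sum a R"
    using R assms(4) by (intro sum_mono2) (auto intro: finite_subset)
  also have "\<dots> \<le> max_sum N k a"
    unfolding max_sum_def using R finite_subsets_card by (intro Max_ge) auto
  finally show ?thesis .
qed

lemma max_sum_mono:
  assumes "k \<le> N" "\<And>i. i \<in> {1..N} \<Longrightarrow> a i \<le> b i"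
  shows "max_sum N k a \<le> max_sum N k b"
proof -
  obtain R where "R \<subseteq> {1..N}" "card R = k"
    using exists_subset_between[of "{}" k "{1..N}"] assms(1) by auto
  then have "{Q. Q \<subseteq> {1..N} \<and> card Q = k} \<noteq> {}"
    by blast
  moreover have "sum a Q \<le> max_sum N k b" if "Q \<subseteq> {1..N}" "card Q = k" for Q
  proof -
    have "sum a Q \<le> sum b Q"
      using that assms(2) by (intro sum_mono) auto
    also have "\<dots> \<le> max_sum N k b"
      unfolding max_sum_def using that finite_subsets_card by (intro Max_ge) auto
    finally show ?thesis .
  qed
  ultimately show ?thesis
    unfolding max_sum_def[of N k a] using finite_subsets_card by (subst Max_le_iff) auto
qed

section \<open>Variances bounded by diameters\<close>

lemma mean_linear:
  assumes "linear T"
  shows "mean \<mu> (\<lambda>x. T (F x)) = T (mean \<mu> F)"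
  by (simp add: mean_def linear_sum[OF assms] linear_scale[OF assms])

text \<open>\<open>z - mean \<mu> F\<close> is a weighted average of the vectors
  \<open>z - F y\<close>, so replacing a point by the mean costs no extra factor.\<close>

lemma norm_sub_mean_le:
  assumes "finite (set_pmf \<mu>)" "\<And>y. y \<in> set_pmf \<mu> \<Longrightarrow> norm (z - F y) \<le> d"
  shows "norm (z - mean \<mu> F) \<le> d"
proof -
  have "z - mean \<mu> F = (\<Sum>y\<in>set_pmf \<mu>. pmf \<mu> y *\<^sub>R (z - F y))"
    using assms(1) by (simp add: mean_def scaleR_diff_right sum_subtractf
        scaleR_sum_left[symmetric] sum_pmf_eq_1)
  also have "norm \<dots> \<le> (\<Sum>y\<in>set_pmf \<mu>. norm (pmf \<mu> y *\<^sub>R (z - F y)))"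
    by (rule norm_sum)
  also have "\<dots> = mean \<mu> (\<lambda>y. norm (z - F y))"
    by (simp add: mean_def)
  also have "\<dots> \<le> d"
    using assms by (rule mean_le)
  finally show ?thesis .
qed

lemma norm_vec_sq: "(norm (y :: 'e::real_inner ^ 'm::finite))\<^sup>2 = (\<Sum>j\<in>UNIV. (norm (y $ j))\<^sup>2)"
  by (simp add: power2_norm_eq_inner inner_vec_def)

text \<open>Rescaling multiplies the diameter of component \<open>j\<close> by
  \<open>sqrt (Lt j)\<close>; the distance to the mean obeys the same bound, and squaring produces
  the weight \<open>Lt j\<close> of \<open>D\<close>.\<close>

lemma var_Y_le_D:
  fixes g :: "nat \<Rightarrow> 'm::finite \<Rightarrow> 'x \<Rightarrow> 'e::real_inner"
  assumes bounded: "\<And>j. bounded (g i j ` X i)" and Lt: "\<And>j. 0 < Lt j"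
    and \<mu>: "\<mu> \<in> finite_pmfs (Y X g Lt i)"
  shows "var \<mu> id \<le> D X g Lt i"
proof -
  have fin: "finite (set_pmf \<mu>)" and sub: "set_pmf \<mu> \<subseteq> Y X g Lt i"
    using \<mu> by (auto simp: finite_pmfs_def)
  have comp: "norm (y $ j - y' $ j) \<le> sqrt (Lt j) * diameter (g i j ` X i)"
    if y: "y \<in> set_pmf \<mu>" and y': "y' \<in> set_pmf \<mu>" for y y' j
  proof -
    from subsetD[OF sub y] subsetD[OF sub y']
    obtain x x' where "x \<in> X i" "x' \<in> X i" "y $ j = sqrt (Lt j) *\<^sub>R g i j x"
      "y' $ j = sqrt (Lt j) *\<^sub>R g i j x'"
      by (auto simp: Y_def vec_map_def rescaled_def)
    moreover from this have "norm (g i j x - g i j x') \<le> diameter (g i j ` X i)"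
      using diameter_bounded_bound[OF bounded] by (simp add: dist_norm[symmetric])
    ultimately show ?thesis
      using Lt[of j] by (simp add: scaleR_diff_right[symmetric] mult_left_mono)
  qed
  have "(norm (y - mean \<mu> id))\<^sup>2 \<le> D X g Lt i" if y: "y \<in> set_pmf \<mu>" for y
  proof -
    have "(norm (y $ j - mean \<mu> id $ j))\<^sup>2 \<le> Lt j * (diameter (g i j ` X i))\<^sup>2" for j
    proof -
      have "mean \<mu> id $ j = mean \<mu> (\<lambda>y. y $ j)"
        by (simp add: mean_def)
      then have "norm (y $ j - mean \<mu> id $ j) \<le> sqrt (Lt j) * diameter (g i j ` X i)"
        using norm_sub_mean_le[OF fin comp[OF y]] by simp
      then have "(norm (y $ j - mean \<mu> id $ j))\<^sup>2 \<le> (sqrt (Lt j) * diameter (g i j ` X i))\<^sup>2"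
        by (rule power_mono) simp
      then show ?thesis
        using Lt[of j] by (simp add: power_mult_distrib)
    qed
    then show ?thesis
      by (simp add: norm_vec_sq D_def sum_mono)
  qed
  then have "mean \<mu> (\<lambda>y. (norm (y - mean \<mu> id))\<^sup>2) \<le> D X g Lt i"
    by (intro mean_le[OF fin])
  then show ?thesis
    by (simp add: var_def mean_def)
qed

section \<open>Averages in convex hulls and lower bounds for the objective\<close>

text \<open>Convex hulls commute with Minkowski sums and scaling. This places randomized means, and
  not only realizations, where the regularity of \<open>f j\<close> is assumed.\<close>

lemma average_in_convex_hull_avg_set:
  assumes "\<And>i. i \<in> {1..N} \<Longrightarrow> m i \<in> convex hull (g i j ` X i)"
  shows "(1 / real N) *\<^sub>R (\<Sum>i=1..N. m i) \<in> convex hull (avg_set N X g j)"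
proof -
  have "(\<Sum>i=1..N. m i) \<in> (\<Sum>i=1..N. convex hull (g i j ` X i))"
    using assms by (auto simp: set_sum_alt)
  then show ?thesis
    unfolding avg_set_def convex_hull_scaling convex_hull_set_sum by (rule imageI)
qed

lemma J_component_in_convex_hull:
  assumes "\<And>i. i \<in> {1..N} \<Longrightarrow> x i \<in> X i"
  shows "((1 / real N) *\<^sub>R (\<Sum>i=1..N. vec_map g i (x i))) $ j \<in> convex hull (avg_set N X g j)"
  using average_in_convex_hull_avg_set[of N "\<lambda>i. g i j (x i)" g j X] assms
  by (simp add: vec_map_def hull_inc)

text \<open>A real infimum is known to be a lower bound only over a set bounded below. Finite
  diameters limit how far the averages move, and the Lipschitz constants limit how far the values
  drop.\<close>

lemma bdd_below_J:
  fixes g :: "nat \<Rightarrow> 'm::finite \<Rightarrow> 'x \<Rightarrow> 'e::real_inner"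
  assumes ne: "\<And>i. i \<in> {1..N} \<Longrightarrow> X i \<noteq> {}" and A: "assumption1 N X E g f L Lt"
  shows "bdd_below (J N g f ` (\<Pi>\<^sub>E i\<in>{1..N}. X i))"
proof -
  have "\<forall>i\<in>{1..N}. \<exists>x. x \<in> X i"
    using ne by blast
  then obtain x0 where x0: "\<And>i. i \<in> {1..N} \<Longrightarrow> x0 i \<in> X i"
    by metis
  define pt where "pt x = (1 / real N) *\<^sub>R (\<Sum>i=1..N. vec_map g i (x i))" for x
  define r where "r j = 1 / real N * (\<Sum>i=1..N. diameter (g i j ` X i))" for j
  \<comment> \<open>The left side does not depend on \<open>x\<close>; writing it with
    \<open>sum_fun\<close> of a function ignoring \<open>y\<close> lets both sides unfold to sums
    over \<open>j\<close>.\<close>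
  have "sum_fun (\<lambda>j y. f j (pt x0 $ j) - L j * r j) (pt x0) \<le> J N g f x"
    if x: "x \<in> (\<Pi>\<^sub>E i\<in>{1..N}. X i)" for x
    unfolding J_def sum_fun_def pt_def[symmetric]
  proof (rule sum_mono)
    fix j :: 'm
    have xX: "x i \<in> X i" if "i \<in> {1..N}" for i
      using x that by auto
    have lip: "(L j)-lipschitz_on (convex hull (avg_set N X g j)) (f j)"
      using A by (simp add: assumption1_def)
    have "pt x $ j - pt x0 $ j = (1 / real N) *\<^sub>R (\<Sum>i=1..N. g i j (x i) - g i j (x0 i))"
      by (simp add: pt_def vec_map_def sum_subtractf scaleR_diff_right)
    then have "norm (pt x $ j - pt x0 $ j) = 1 / real N * norm (\<Sum>i=1..N. g i j (x i) - g i j (x0 i))"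
      by simp
    also have "\<dots> \<le> 1 / real N * (\<Sum>i=1..N. norm (g i j (x i) - g i j (x0 i)))"
      by (intro mult_left_mono norm_sum) simp
    also have "\<dots> \<le> r j"
      unfolding r_def
    proof (intro mult_left_mono sum_mono)
      fix i assume i: "i \<in> {1..N}"
      then have "bounded (g i j ` X i)"
        using A by (simp add: assumption1_def)
      then show "norm (g i j (x i) - g i j (x0 i)) \<le> diameter (g i j ` X i)"
        using diameter_bounded_bound[OF _ imageI[OF xX[OF i]] imageI[OF x0[OF i]]]
        by (simp add: dist_norm[symmetric])
    qed simp
    finally have "L j * dist (pt x0 $ j) (pt x $ j) \<le> L j * r j"
      using lipschitz_on_nonneg[OF lip] by (intro mult_left_mono) (simp_all add: dist_norm norm_minus_commute)
    moreover have "dist (f j (pt x0 $ j)) (f j (pt x $ j)) \<le> L j * dist (pt x0 $ j) (pt x $ j)"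
      unfolding pt_def by (intro lipschitz_onD[OF lip] J_component_in_convex_hull x0 xX)
    ultimately show "f j (pt x0 $ j) - L j * r j \<le> f j (pt x $ j)"
      by (simp add: dist_real_def)
  qed
  then show ?thesis
    by (intro bdd_belowI2)
qed

section \<open>From variances to values of the objective\<close>

text \<open>The squared norm of a rescaled vector is the sum of \<open>Lt j\<close> times the
  squared norms of its components, the form taken by the quadratic remainders. Being linear, the map
  commutes with means.\<close>

definition rescale :: "('m \<Rightarrow> real) \<Rightarrow> 'e::real_vector ^ 'm::finite \<Rightarrow> 'e ^ 'm" where
  "rescale Lt y = (\<chi> j. sqrt (Lt j) *\<^sub>R y $ j)"

lemma linear_rescale: "linear (rescale Lt)"
  by (rule linearI) (simp_all add: rescale_def vec_eq_iff scaleR_add_right)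

lemma vec_map_rescaled: "vec_map (rescaled Lt g) i = (\<lambda>x. rescale Lt (vec_map g i x))"
  by (simp add: fun_eq_iff vec_map_def rescaled_def rescale_def)

text \<open>The measures live on the image sets \<open>Y X g Lt i\<close>, where Shapley-Folkman
  operates; preimages in \<open>X i\<close> are picked only after the selection. The individual
  means are free: only their sum is tied to \<open>a\<close>.\<close>

lemma exists_J_le_variance:
  fixes g :: "nat \<Rightarrow> 'm::finite \<Rightarrow> 'x \<Rightarrow> 'e::real_inner"
  assumes N: "N \<ge> 1" and A: "assumption1 N X E g f L Lt"
    and \<nu>: "\<And>i. i \<in> {1..N} \<Longrightarrow> \<nu> i \<in> finite_pmfs (Y X g Lt i)"
    and a: "\<And>j. a $ j \<in> convex hull (avg_set N X g j)"
    and mean_\<nu>: "(\<Sum>i=1..N. mean (\<nu> i) id) = real N *\<^sub>R rescale Lt a"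
  obtains x where "x \<in> (\<Pi>\<^sub>E i\<in>{1..N}. X i)"
    "J N g f x \<le> sum_fun f a + 1 / (2 * (real N)\<^sup>2) * (\<Sum>i=1..N. var (\<nu> i) id)"
proof -
  define C where "C j = convex hull (avg_set N X g j)" for j
  have Lt: "0 < Lt j" for j
    using A by (simp add: assumption1_def)
  have "\<exists>G. (\<forall>z\<in>C j. (f j has_derivative (\<lambda>h. G z \<bullet> h)) (at z within C j)) \<and> (Lt j)-lipschitz_on (C j) G" for j
  proof -
    from A obtain U G where U: "openin (top_of_set (E j)) U" "C j \<subseteq> U"
      and G: "\<And>y. y \<in> U \<Longrightarrow> has_gradient_in (E j) (f j) (G y) y" "(Lt j)-lipschitz_on (C j) G"
      unfolding assumption1_def C_def by meson
    \<comment> \<open>The gradient is given within \<open>E j\<close>; as the hull lies in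
      \<open>E j\<close>, the derivative restricts to the hull.\<close>
    have "C j \<subseteq> E j"
      using U openin_imp_subset by blast
    then have "(f j has_derivative (\<lambda>h. G z \<bullet> h)) (at z within C j)" if "z \<in> C j" for z
      using G(1)[of z] U(2) that by (auto simp: has_gradient_in_def intro: has_derivative_subset)
    with G(2) show ?thesis
      by blast
  qed
  then obtain G where G: "\<And>j z. z \<in> C j \<Longrightarrow> (f j has_derivative (\<lambda>h. G j z \<bullet> h)) (at z within C j)"
    "\<And>j. (Lt j)-lipschitz_on (C j) (G j)"
    by metis
  \<comment> \<open>Paired with the total deviation \<open>real N *\<^sub>R u\<close>, this vector
    cancels \<open>sqrt (Lt j)\<close> and yields the first-order term with the factor
    \<open>N^2\<close> that the squared norm carries as well.\<close>
  define w where "w = (\<chi> j. (real N / sqrt (Lt j)) *\<^sub>R G j (a $ j))"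
  obtain s where s: "\<And>i. i \<in> {1..N} \<Longrightarrow> s i \<in> set_pmf (\<nu> i)"
    "2 * (w \<bullet> (\<Sum>i=1..N. id (s i) - mean (\<nu> i) id)) + (norm (\<Sum>i=1..N. id (s i) - mean (\<nu> i) id))\<^sup>2
       \<le> (\<Sum>i=1..N. var (\<nu> i) id)"
    using exists_selection_le_variance[of "{1..N}" \<nu> w "\<lambda>_. id"] \<nu> by (auto simp: finite_pmfs_def)
  have "\<forall>i\<in>{1..N}. \<exists>x\<in>X i. s i = rescale Lt (vec_map g i x)"
    using s(1) \<nu> by (fastforce simp: finite_pmfs_def Y_def vec_map_rescaled)
  then obtain x0 where x0: "\<And>i. i \<in> {1..N} \<Longrightarrow> x0 i \<in> X i"
    "\<And>i. i \<in> {1..N} \<Longrightarrow> s i = rescale Lt (vec_map g i (x0 i))"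
    by metis
  define x where "x = restrict x0 {1..N}"
  have x: "x \<in> (\<Pi>\<^sub>E i\<in>{1..N}. X i)"
    using x0(1) by (simp add: x_def)
  define b where "b = (1 / real N) *\<^sub>R (\<Sum>i=1..N. vec_map g i (x i))"
  define u where "u = rescale Lt (b - a)"
  have "(\<Sum>i=1..N. s i) = rescale Lt (\<Sum>i=1..N. vec_map g i (x i))"
    unfolding linear_sum[OF linear_rescale] by (intro sum.cong) (auto simp: x0(2) x_def)
  also have "(\<Sum>i=1..N. vec_map g i (x i)) = real N *\<^sub>R b"
    using N by (simp add: b_def)
  finally have Z: "(\<Sum>i=1..N. id (s i) - mean (\<nu> i) id) = real N *\<^sub>R u"
    by (simp add: sum_subtractf mean_\<nu> u_def linear_diff[OF linear_rescale]
        linear_scale[OF linear_rescale] scaleR_diff_right del: One_nat_def)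
  have w_u: "w \<bullet> (real N *\<^sub>R u) = (real N)\<^sup>2 * (\<Sum>j\<in>UNIV. G j (a $ j) \<bullet> (b $ j - a $ j))"
  proof -
    have "sqrt (Lt j) \<noteq> 0" for j
      using Lt[of j] by simp
    then show ?thesis
      by (simp add: inner_vec_def w_def u_def rescale_def sum_distrib_left power2_eq_square mult.assoc)
  qed
  have u_sq: "(norm u)\<^sup>2 = (\<Sum>j\<in>UNIV. Lt j * (norm (b $ j - a $ j))\<^sup>2)"
    using Lt by (simp add: norm_vec_sq u_def rescale_def power_mult_distrib less_imp_le)
  have "J N g f x = (\<Sum>j\<in>UNIV. f j (b $ j))"
    by (simp add: J_def sum_fun_def b_def)
  also have "\<dots> \<le> (\<Sum>j\<in>UNIV. f j (a $ j) + G j (a $ j) \<bullet> (b $ j - a $ j)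
      + Lt j / 2 * (norm (b $ j - a $ j))\<^sup>2)"
  proof (intro sum_mono descent_lemma[OF _ _ _ G])
    fix j :: 'm
    show "convex (C j)" "a $ j \<in> C j"
      using a by (simp_all add: C_def)
    show "b $ j \<in> C j"
      unfolding b_def C_def using x by (intro J_component_in_convex_hull) auto
  qed
  also have "\<dots> = sum_fun f a + (\<Sum>j\<in>UNIV. G j (a $ j) \<bullet> (b $ j - a $ j)) + (norm u)\<^sup>2 / 2"
    by (simp add: u_sq sum_fun_def sum.distrib sum_divide_distrib)
  also have "\<dots> = sum_fun f a + 1 / (2 * (real N)\<^sup>2) *
      (2 * (w \<bullet> (real N *\<^sub>R u)) + (norm (real N *\<^sub>R u))\<^sup>2)"
    unfolding w_u using N by (simp add: power_mult_distrib field_simps)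
  also have "\<dots> \<le> sum_fun f a + 1 / (2 * (real N)\<^sup>2) * (\<Sum>i=1..N. var (\<nu> i) id)"
    using s(2) unfolding Z by (intro add_left_mono mult_left_mono) auto
  finally show thesis
    using that x by blast
qed

section \<open>Dimension of the product space\<close>

lemma subspace_prod_space:
  assumes "\<And>j. subspace (E j)"
  shows "subspace (prod_space E)"
  using assms by (auto simp: prod_space_def subspace_def)

text \<open>Finite \<open>edim\<close> promises some finite spanning set of any size; a basis taken
  inside \<open>V\<close> has exactly \<open>dim V\<close> elements, the count that Shapley-Folkman
  needs.\<close>

lemma edim_eq_enatE:
  assumes "edim V = enat n"
  obtains B where "finite B" "V \<subseteq> span B" "card B = n"
proof -
  obtain B0 where B0: "finite B0" "V \<subseteq> span B0" and n: "dim V = n"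
    using assms by (auto simp: edim_def split: if_splits)
  obtain B where B: "B \<subseteq> V" "independent B" "V \<subseteq> span B" "card B = dim V"
    using basis_exists by blast
  then have "finite B"
    using independent_span_bound[OF B0(1)] B0(2) by blast
  then show thesis
    using that B n by simp
qed

section \<open>The gap between the deterministic and the randomized infimum\<close>

theorem theorem4p4:
  fixes N :: nat
    and X :: "nat \<Rightarrow> 'x set"
    and E :: "'m::finite \<Rightarrow> 'e::real_inner set"
    and g :: "nat \<Rightarrow> 'm \<Rightarrow> 'x \<Rightarrow> 'e"
    and f :: "'m \<Rightarrow> 'e \<Rightarrow> real"
    and L Lt :: "'m \<Rightarrow> real"
    and q :: enat and k :: nat
  assumes "N \<ge> 1"
    and "\<And>i. i \<in> {1..N} \<Longrightarrow> X i \<noteq> {}"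
    and "\<And>j. separable_hilbert (E j)"
    and "\<And>i j. i \<in> {1..N} \<Longrightarrow> g i j \<in> X i \<rightarrow> E j"
    and "assumption1 N X E g f L Lt"
    and "q = edim (prod_space E)"
    and "enat k = min q (enat N)"
  shows "J_inf N X g f - J_rand_inf N X g f
           \<le> 1 / (2 * (real N)\<^sup>2) * max_sum N k (\<lambda>i. (nonconvexity (Y X g Lt i))\<^sup>2)
       \<and> 1 / (2 * (real N)\<^sup>2) * max_sum N k (\<lambda>i. (nonconvexity (Y X g Lt i))\<^sup>2)
           \<le> max_sum N k (D X g Lt) / (2 * (real N)\<^sup>2)"
proof -
  define S where "S i = Y X g Lt i" for i
  define \<rho>2 where "\<rho>2 i = (nonconvexity (S i))\<^sup>2" for i
  have k: "k \<le> N"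
    using assms(7) by (metis enat_ord_simps(1) min.cobounded2)
  have S_ne: "S i \<noteq> {}" if "i \<in> {1..N}" for i
    using assms(2)[OF that] by (simp add: S_def Y_def)
  have var_S: "var \<mu> id \<le> D X g Lt i" if "i \<in> {1..N}" "\<mu> \<in> finite_pmfs (S i)" for i \<mu>
    by (rule var_Y_le_D) (use assms(5) that in \<open>auto simp: assumption1_def S_def\<close>)
  have \<rho>2_le: "\<rho>2 i \<le> D X g Lt i" if "i \<in> {1..N}" for i
    unfolding \<rho>2_def using S_ne[OF that] var_S[OF that] by (rule nonconvexity_sq_le)
  have bdd: "bdd_below (J N g f ` (\<Pi>\<^sub>E i\<in>{1..N}. X i))"
    using assms(2,5) by (rule bdd_below_J)
  have main: "J_inf N X g f - 1 / (2 * (real N)\<^sup>2) * max_sum N k \<rho>2 \<le> J_rand N g f \<mu>"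
    if \<mu>: "\<mu> \<in> (\<Pi>\<^sub>E i\<in>{1..N}. finite_pmfs (X i))" for \<mu>
  proof (rule field_le_epsilon)
    fix e :: real assume e: "0 < e"
    \<comment> \<open>Each of the \<open>N\<close> variances may exceed its target by
      \<open>\<epsilon>\<close>; after the factor \<open>1 / (2 * N^2)\<close> the total excess is
      exactly \<open>e\<close>.\<close>
    define \<epsilon> where "\<epsilon> = e * (2 * (real N)\<^sup>2) / real N"
    have \<epsilon>: "0 < \<epsilon>"
      using e assms(1) by (simp add: \<epsilon>_def)
    have \<mu>_in: "\<mu> i \<in> finite_pmfs (X i)" if "i \<in> {1..N}" for i
      using \<mu> that by auto
    define a where "a = (1 / real N) *\<^sub>R (\<Sum>i=1..N. mean (\<mu> i) (vec_map g i))"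
    define y where "y i = rescale Lt (mean (\<mu> i) (vec_map g i))" for i
    have y_hull: "y i \<in> convex hull S i" if "i \<in> {1..N}" for i
    proof -
      have "y i = mean (\<mu> i) (vec_map (rescaled Lt g) i)"
        by (simp add: y_def mean_linear[OF linear_rescale] vec_map_rescaled)
      then show ?thesis
        using mean_in_convex_hull[OF \<mu>_in[OF that]] by (simp add: S_def Y_def)
    qed
    have sum_y: "sum y {1..N} = real N *\<^sub>R rescale Lt a"
      using assms(1) by (simp add: y_def a_def linear_sum[OF linear_rescale]
          linear_scale[OF linear_rescale])
    have a_hull: "a $ j \<in> convex hull (avg_set N X g j)" for j
    proof -
      have "a $ j = (1 / real N) *\<^sub>R (\<Sum>i=1..N. mean (\<mu> i) (g i j))"
        by (simp add: a_def mean_def vec_map_def)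
      also have "\<dots> \<in> convex hull (avg_set N X g j)"
        by (intro average_in_convex_hull_avg_set mean_in_convex_hull \<mu>_in)
      finally show ?thesis .
    qed
    \<comment> \<open>If \<open>k = N\<close>, which includes infinite \<open>q\<close>, the points
      \<open>y i\<close> serve unchanged. Otherwise the minimum is \<open>q\<close>, so the
      dimension is finite and equals \<open>k\<close>.\<close>
    obtain z where z: "\<And>i. i \<in> {1..N} \<Longrightarrow> z i \<in> convex hull S i" "sum z {1..N} = sum y {1..N}"
      "card {i\<in>{1..N}. z i \<notin> S i} \<le> k"
    proof (cases "k = N")
      case True
      have "card {i\<in>{1..N}. y i \<notin> S i} \<le> card {1..N}"
        by (rule card_mono) auto
      then show thesis
        using that[of y] y_hull True by simp
    next
      case False
      then have "edim (prod_space E) = enat k"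
        using assms(6,7) by (metis enat.inject min_def)
      then obtain B where B: "finite B" "prod_space E \<subseteq> span B" "card B = k"
        by (rule edim_eq_enatE)
      have E: "subspace (E j)" for j
        using assms(3) by (simp add: separable_hilbert_def)
      have S_E: "S i \<subseteq> prod_space E" if "i \<in> {1..N}" for i
        using funcset_mem[OF assms(4)[OF that]] E
        by (auto simp: S_def Y_def prod_space_def vec_map_def rescaled_def intro!: subspace_scale)
      show thesis
        by (rule Shapley_Folkman[OF finite_atLeastAtMost subspace_prod_space[OF E] S_E B(2,1) y_hull])
          (use that B(3) in blast)+
    qed
    define Q where "Q = {i\<in>{1..N}. z i \<notin> S i}"
    \<comment> \<open>Outside \<open>Q\<close> the point \<open>z i\<close> lies in
      \<open>S i\<close>, and its point mass has variance 0; only indices of \<open>Q\<close> pay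
      their nonconvexity.\<close>
    have "\<forall>i\<in>{1..N}. \<exists>\<nu>\<in>finite_pmfs (S i). mean \<nu> id = z i \<and> var \<nu> id \<le> (if i \<in> Q then \<rho>2 i else 0) + \<epsilon>"
    proof
      fix i assume i: "i \<in> {1..N}"
      show "\<exists>\<nu>\<in>finite_pmfs (S i). mean \<nu> id = z i \<and> var \<nu> id \<le> (if i \<in> Q then \<rho>2 i else 0) + \<epsilon>"
      proof (cases "i \<in> Q")
        case True
        then show ?thesis
          using ex_var_less_nonconvexity_sq[OF S_ne[OF i] var_S[OF i] z(1)[OF i] \<epsilon>]
          by (auto simp: \<rho>2_def intro: less_imp_le)
      next
        case False
        then show ?thesis
          using i \<epsilon> by (intro bexI[of _ "return_pmf (z i)"]) (auto simp: Q_def)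
      qed
    qed
    then obtain \<nu> where \<nu>: "\<And>i. i \<in> {1..N} \<Longrightarrow> \<nu> i \<in> finite_pmfs (S i)"
      "\<And>i. i \<in> {1..N} \<Longrightarrow> mean (\<nu> i) id = z i"
      "\<And>i. i \<in> {1..N} \<Longrightarrow> var (\<nu> i) id \<le> (if i \<in> Q then \<rho>2 i else 0) + \<epsilon>"
      by metis
    have "(\<Sum>i=1..N. mean (\<nu> i) id) = real N *\<^sub>R rescale Lt a"
      using \<nu>(2) z(2) sum_y by simp
    then obtain x where x: "x \<in> (\<Pi>\<^sub>E i\<in>{1..N}. X i)"
      "J N g f x \<le> sum_fun f a + 1 / (2 * (real N)\<^sup>2) * (\<Sum>i=1..N. var (\<nu> i) id)"
      using exists_J_le_variance[OF assms(1,5) \<nu>(1)[unfolded S_def] a_hull] by metis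
    have "(\<Sum>i=1..N. var (\<nu> i) id) \<le> (\<Sum>i=1..N. (if i \<in> Q then \<rho>2 i else 0) + \<epsilon>)"
      using \<nu>(3) by (intro sum_mono) auto
    also have "\<dots> = sum \<rho>2 ({1..N} \<inter> Q) + real N * \<epsilon>"
      by (simp add: sum.distrib sum.inter_restrict)
    also have "{1..N} \<inter> Q = Q"
      by (auto simp: Q_def)
    also have "sum \<rho>2 Q \<le> max_sum N k \<rho>2"
      using z(3) k by (intro sum_le_max_sum) (auto simp: Q_def \<rho>2_def)
    also have "real N * \<epsilon> = e * (2 * (real N)\<^sup>2)"
      using assms(1) by (simp add: \<epsilon>_def)
    finally have "1 / (2 * (real N)\<^sup>2) * (\<Sum>i=1..N. var (\<nu> i) id)
        \<le> 1 / (2 * (real N)\<^sup>2) * (max_sum N k \<rho>2 + e * (2 * (real N)\<^sup>2))"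
      by (rule mult_left_mono) auto
    also have "\<dots> = 1 / (2 * (real N)\<^sup>2) * max_sum N k \<rho>2 + e"
      using assms(1) by (simp add: distrib_left)
    finally have "J N g f x \<le> J_rand N g f \<mu> + 1 / (2 * (real N)\<^sup>2) * max_sum N k \<rho>2 + e"
      using x(2) by (simp add: J_rand_def a_def)
    moreover have "J_inf N X g f \<le> J N g f x"
      unfolding J_inf_def using bdd x(1) by (rule cINF_lower)
    ultimately show "J_inf N X g f - 1 / (2 * (real N)\<^sup>2) * max_sum N k \<rho>2 \<le> J_rand N g f \<mu> + e"
      by simp
  qed
  have "\<forall>i\<in>{1..N}. \<exists>x. x \<in> X i"
    using assms(2) by blast
  then obtain x0 where "\<And>i. i \<in> {1..N} \<Longrightarrow> x0 i \<in> X i"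
    by metis
  \<comment> \<open>Point masses show that randomized decisions exist, so the bound valid for each
    of them passes to the infimum.\<close>
  then have "restrict (return_pmf \<circ> x0) {1..N} \<in> (\<Pi>\<^sub>E i\<in>{1..N}. finite_pmfs (X i))"
    by simp
  then have "(\<Pi>\<^sub>E i\<in>{1..N}. finite_pmfs (X i)) \<noteq> {}"
    by blast
  then have "J_inf N X g f - 1 / (2 * (real N)\<^sup>2) * max_sum N k \<rho>2 \<le> J_rand_inf N X g f"
    unfolding J_rand_inf_def using main by (rule cINF_greatest)
  moreover have "1 / (2 * (real N)\<^sup>2) * max_sum N k \<rho>2 \<le> 1 / (2 * (real N)\<^sup>2) * max_sum N k (D X g Lt)"
    using max_sum_mono[OF k \<rho>2_le] by (intro mult_left_mono) auto
  ultimately show ?thesis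
    unfolding \<rho>2_def S_def by simp
qed

end
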